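(* Let $2\le k\le n-1$, let $\gamma_k\in(0,1)$ be as specified in the context, and let $\delta_0\in(0,1)$ be a number depending only on $k,n,\gamma_k$ with the following property: there is $C_{10}>0$, depending only on $k,n,\gamma_k,\delta_0$, such that $d^2F_k(R,P)\le -C_{10}|\tilde{\tilde P}|^2$ for all $\mu>0$, all $0<\delta\le\delta_0$, all $R\in D_{\delta,\mu,\gamma_k}$ and all $P=P^T\in\mathbb{R}^{n\times n}$. Then there exist $0<\delta_1\le\delta_0$ and $C_{12}>0$, depending on $k,n,\gamma_k,\delta_0$ and not depending on $\mu$, such that for all $\mu>0$, all $0<\delta\le\delta_1$, all $R=\omega+\beta\in D_{\delta,\mu,\gamma_k}$ (with $\omega^T=\omega$, $\beta^T=-\beta$) and all $M=P+Q\in\mathbb{R}^{n\times n}$ with $P^T=P$, $Q^T=-Q$, $$d^2F_k(R,M)\le C_{12}\frac{|Q|^2}{\lambda_{\min}^2(\omega)} .$$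
   Context: For $R\in\mathbb{R}^{n\times n}$, $S_k(R)=\sigma_k(\lambda(R))$, where $\lambda(R)\in\mathbb{C}^n$ is the vector of eigenvalues of $R$ and $\sigma_k(\lambda)=\sum_{1\le i_1<\cdots<i_k\le n}\lambda_{i_1}\cdots\lambda_{i_k}$; equivalently $S_k(R)$ is the sum of all $k\times k$ principal minors of $R$. $F_k(R)=\log S_k(R)$, and for $M\in\mathbb{R}^{n\times n}$, $d^2F_k(R,M)=\sum_{i,j,\ell,m=1}^n\frac{\partial^2F_k(R)}{\partial R_{ij}\partial R_{\ell m}}M_{ij}M_{\ell m}$. $|M|=(\sum_{i,j}M_{ij}^2)^{1/2}$, $\|\cdot\|$ is the operator norm, $\lambda_{\min}(\omega)$ is the least eigenvalue of $\omega$. For $0\le\delta<1$, $\mu\ge0$: $D_{\delta,\mu}$ is the set of $R=\omega+\beta\in\mathbb{R}^{n\times n}$ with $\omega^T=\omega>0$, $\beta^T=-\beta$, $\|\beta\|\le\mu$ and $\mu\le\delta\lambda_{\min}(\omega)$. $\Gamma_n=\{\lambda\in\mathbb{R}^n:\lambda_j>0,\ j=1,\dots,n\}$. $\Sigma_{(\gamma_k)}$ is the set of $\lambda\in\Gamma_n$ with $\min_j\lambda_j\ge\gamma_k\max_j\lambda_j$, where: (i) if $k\in\{2,3,4,n-2,n-1\}$, $\gamma_k$ is some fixed number in $(0,1)$; (ii) if $[\frac n2]+1\le k\le n-3$, $\gamma_k=\frac{n-k}{k}$; (iii) if $5\le k\le[\frac n2]$, $\gamma_k=\frac{k-2}{n-(k-2)}$.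 For $0<\delta<1$, $\mu>0$: $D_{\delta,\mu,\gamma_k}=\{R=\omega+\beta\in D_{\delta,\mu}:\lambda(\omega)\in\Sigma_{(\gamma_k)}\}$. For $R=\omega+\beta\in D_{\delta,\mu}$ write $\omega=C^{-1}DC$ with $C$ orthogonal and $D=\mathrm{diag}(\lambda_1,\dots,\lambda_n)$, and set $\widetilde P=CPC^{-1}$, $\tilde{\tilde P}=D^{-1/2}\widetilde PD^{-1/2}$. *)

theory Defs
  imports "HOL-Analysis.Analysis" "HOL-Computational_Algebra.Polynomial"
begin

definition charpoly :: "'a::comm_ring_1^'n^'n \<Rightarrow> 'a poly" where
  "charpoly A = det (mat [:0, 1:] - map_matrix (\<lambda>a. [:a:]) A)"

text \<open>
  The vector of eigenvalues, repeated according to algebraic multiplicity, in an arbitrarily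
  chosen order; every use below is invariant under reordering.  It is meaningful whenever the
  characteristic polynomial splits over the base field: for every complex matrix, and for every
  symmetric real matrix.
\<close>
definition eigvals :: "'a::field^'n^'n \<Rightarrow> 'a^'n" where
  "eigvals A = (SOME lam. charpoly A = (\<Prod>i\<in>UNIV. [:- (lam $ i), 1:]))"

definition sigma :: "nat \<Rightarrow> 'a::comm_ring_1^'n \<Rightarrow> 'a" where
  "sigma k lam = (\<Sum>I | I \<subseteq> UNIV \<and> card I = k. \<Prod>i\<in>I. lam $ i)"

text \<open>
  The eigenvalues of a real matrix are taken in the complex numbers; their elementary symmetric
  functions are real, so taking the real part only changes the type.
\<close>
definition S :: "nat \<Rightarrow> real^'n^'n \<Rightarrow> real" where
  "S k R = Re (sigma k (eigvals (map_matrix complex_of_real R)))"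

definition F :: "nat \<Rightarrow> real^'n^'n \<Rightarrow> real" where
  "F k R = ln (S k R)"

text \<open>Here \<open>axis i (axis j 1)\<close> is the matrix unit with a one in row i, column j.\<close>
definition entry_deriv ::
    "'n \<Rightarrow> 'n \<Rightarrow> (real^'n^'n \<Rightarrow> real) \<Rightarrow> real^'n^'n \<Rightarrow> real" where
  "entry_deriv i j f R = deriv (\<lambda>t. f (R + t *\<^sub>R axis i (axis j 1))) 0"

definition d2F :: "nat \<Rightarrow> real^'n^'n \<Rightarrow> real^'n^'n \<Rightarrow> real" where
  "d2F k R M = (\<Sum>i\<in>UNIV. \<Sum>j\<in>UNIV. \<Sum>l\<in>UNIV. \<Sum>m\<in>UNIV.
     entry_deriv i j (entry_deriv l m (F k)) R * M $ i $ j * M $ l $ m)"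

definition symmetric_mat :: "real^'n^'n \<Rightarrow> bool" where
  "symmetric_mat A \<longleftrightarrow> transpose A = A"

definition skew_mat :: "real^'n^'n \<Rightarrow> bool" where
  "skew_mat A \<longleftrightarrow> transpose A = - A"

definition pos_def_mat :: "real^'n^'n \<Rightarrow> bool" where
  "pos_def_mat A \<longleftrightarrow> (\<forall>x. x \<noteq> 0 \<longrightarrow> 0 < x \<bullet> (A *v x))"

definition lambda_min :: "real^'n^'n \<Rightarrow> real" where
  "lambda_min A = Min (range (\<lambda>i. eigvals A $ i))"

definition diag_mat :: "real^'n \<Rightarrow> real^'n^'n" where
  "diag_mat v = (\<chi> i j. if i = j then v $ i else 0)"

definition D_set :: "real \<Rightarrow> real \<Rightarrow> (real^'n^'n) set" where
  "D_set \<delta> \<mu> = {R. \<exists>\<omega> \<beta>. R = \<omega> + \<beta> \<and> symmetric_mat \<omega> \<and> pos_def_mat \<omega> \<and> skew_mat \<beta> \<and>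
     onorm ((*v) \<beta>) \<le> \<mu> \<and> \<mu> \<le> \<delta> * lambda_min \<omega>}"

definition Gamma_cone :: "(real^'n) set" where
  "Gamma_cone = {lam. \<forall>j. 0 < lam $ j}"

definition Sigma_set :: "real \<Rightarrow> (real^'n) set" where
  "Sigma_set \<gamma> = {lam \<in> Gamma_cone.
     Min (range (\<lambda>j. lam $ j)) \<ge> \<gamma> * Max (range (\<lambda>j. lam $ j))}"

text \<open>
  The first two cases overlap only for n = 7, k = 4; there any value in the open unit interval is
  admitted.
\<close>
definition gamma_admissible :: "nat \<Rightarrow> nat \<Rightarrow> real \<Rightarrow> bool" where
  "gamma_admissible n k \<gamma> \<longleftrightarrow>
     k \<in> {2, 3, 4, n - 2, n - 1} \<and> 0 < \<gamma> \<and> \<gamma> < 1 \<or>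
     n div 2 + 1 \<le> k \<and> k \<le> n - 3 \<and> \<gamma> = (real n - real k) / real k \<or>
     5 \<le> k \<and> k \<le> n div 2 \<and> \<gamma> = (real k - 2) / (real n - (real k - 2))"

definition D_gamma :: "real \<Rightarrow> real \<Rightarrow> real \<Rightarrow> (real^'n^'n) set" where
  "D_gamma \<delta> \<mu> \<gamma> = {R. \<exists>\<omega> \<beta>. R = \<omega> + \<beta> \<and> symmetric_mat \<omega> \<and> skew_mat \<beta> \<and>
     R \<in> D_set \<delta> \<mu> \<and> eigvals \<omega> \<in> Sigma_set \<gamma>}"

definition diagonalizes :: "real^'n^'n \<Rightarrow> real^'n^'n \<Rightarrow> real^'n \<Rightarrow> bool" where
  "diagonalizes \<omega> C lam \<longleftrightarrow>
     orthogonal_matrix C \<and> \<omega> = matrix_inv C ** diag_mat lam ** C"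

text \<open>
  This is the matrix written with a double tilde over P in the paper.  Its Frobenius norm, which is
  the library's norm on matrices, does not depend on the diagonalization chosen.
\<close>
definition P_tilde2 :: "real^'n^'n \<Rightarrow> real^'n \<Rightarrow> real^'n^'n \<Rightarrow> real^'n^'n" where
  "P_tilde2 C lam P = (let D' = diag_mat (\<chi> i. lam $ i powr (- 1 / 2)) in
     D' ** (C ** P ** matrix_inv C) ** D')"

end

theory Submission
  imports Defs "HOL-Computational_Algebra.Fundamental_Theorem_Algebra"
begin

text \<open>
  Expanding the quadratic form \<open>d2F k R\<close> at \<open>P + Q\<close> gives the value at \<open>P\<close>, two mixed terms and the
  value at \<open>Q\<close>.  By hypothesis the first is at most a negative multiple of the squared norm of the
  scaled matrix \<open>P_tilde2\<close>.  Since all eigenvalues of \<open>\<omega>\<close> lie between \<open>lambda_min \<omega>\<close> and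
  \<open>lambda_min \<omega> / \<gamma>\<close>, this is at most \<open>- c * (norm P)\<^sup>2 / (lambda_min \<omega>)\<^sup>2\<close> for some constant \<open>c > 0\<close>
  (\<open>norm_P_tilde2_ge\<close>).  If the remaining terms are bounded by \<open>K * norm M * norm N / (lambda_min \<omega>)\<^sup>2\<close>,
  where \<open>M\<close> and \<open>N\<close> stand for \<open>P\<close> or \<open>Q\<close>, then completing the square absorbs the mixed terms into
  the negative one and leaves a multiple of \<open>(norm Q)\<^sup>2 / (lambda_min \<omega>)\<^sup>2\<close>.  All these
  estimates hold for every \<open>\<delta> \<le> \<delta>\<^sub>0\<close>, so \<open>\<delta>\<^sub>1 = \<delta>\<^sub>0\<close> will do.

  The bound on the remaining terms is a matter of homogeneity and compactness
  (\<open>hessian_form_bound\<close>).  The function \<open>S k\<close> is the sum of the principal minors of size \<open>k\<close>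
  (\<open>S_eq_sum_principal_minors\<close>), hence a homogeneous polynomial in the entries, and it is positive on
  all matrices with positive definite symmetric part (\<open>S_pos\<close>).  Therefore the second partial
  derivatives of \<open>F k\<close> are continuous there and homogeneous of degree \<open>- 2\<close>.  After division by
  \<open>lambda_min \<omega>\<close> the matrices \<open>\<omega> + \<beta>\<close> all lie in one compact set of such matrices, because both the
  eigenvalues of \<open>\<omega>\<close> and the operator norm of \<open>\<beta>\<close> are controlled by \<open>lambda_min \<omega>\<close>.

  To read these facts off from the eigenvalues, \<open>\<omega>\<close> is diagonalized by an orthogonal matrix; the
  spectral theorem is obtained by maximizing the quadratic form on the unit sphere
  (\<open>symmetric_mat_diagonalizable\<close>).
\<close>

section \<open>Elementary symmetric functions of eigenvalues as sums of principal minors\<close>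

lemma det_map_matrix_hom:
  fixes A :: "'a::comm_ring_1^'n^'n" and h :: "'a \<Rightarrow> 'b::comm_ring_1"
  assumes add: "\<And>x y. h (x + y) = h x + h y"
    and mult: "\<And>x y. h (x * y) = h x * h y" and one: "h 1 = 1"
  shows "det (map_matrix h A) = h (det A)"
proof -
  have zero: "h 0 = 0"
    using add[of 0 0] by simp
  have minus: "h (- x) = - h x" for x
    using add[of x "- x"] zero by (simp add: eq_neg_iff_add_eq_0 add.commute)
  have sum: "h (sum f X) = (\<Sum>x\<in>X. h (f x))" for f :: "('n \<Rightarrow> 'n) \<Rightarrow> 'a" and X
    by (induction X rule: infinite_finite_induct) (simp_all add: zero add)
  have prod: "h (prod f X) = (\<Prod>x\<in>X. h (f x))" for f :: "'n \<Rightarrow> 'a" and X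
    by (induction X rule: infinite_finite_induct) (simp_all add: one mult)
  have sign: "h (of_int (sign p)) = of_int (sign p)" for p :: "'n \<Rightarrow> 'n"
    by (cases "evenperm p") (simp_all add: sign_def minus one)
  show ?thesis
    unfolding det_def by (simp add: sum mult prod sign)
qed

text \<open>
  Replacing the rows outside \<open>I\<close> by unit vectors leaves the minor on \<open>I\<close> in a matrix whose size does
  not depend on \<open>I\<close>, so that no submatrix types are needed.
\<close>
definition principal_minor :: "'n set \<Rightarrow> 'a::comm_ring_1^'n^'n \<Rightarrow> 'a" where
  "principal_minor I A = det (\<chi> i. if i \<in> I then A $ i else axis i 1)"

lemma principal_minor_map_matrix_hom:
  assumes "\<And>x y. h (x + y) = h x + h y" "\<And>x y. h (x * y) = h x * h y" "h 1 = 1"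
  shows "principal_minor I (map_matrix h A) = h (principal_minor I A)"
proof -
  have "h 0 = 0"
    using assms(1)[of 0 0] by simp
  then have "(\<chi> i. if i \<in> I then map_matrix h A $ i else axis i 1) =
      map_matrix h (\<chi> i. if i \<in> I then A $ i else axis i 1)"
    by (simp add: vec_eq_iff axis_def assms(3))
  then show ?thesis
    unfolding principal_minor_def by (simp add: det_map_matrix_hom[of h, OF assms])
qed

lemma det_add_expand_rows:
  fixes A B :: "'a::comm_ring_1^'n^'n"
  shows "det (A + B) = (\<Sum>I\<in>UNIV. det (\<chi> i. if i \<in> I then A $ i else B $ i))"
proof -
  have "(\<Prod>i\<in>UNIV. (A + B) $ i $ p i) =
      (\<Sum>I\<in>UNIV. \<Prod>i\<in>UNIV. (\<chi> i. if i \<in> I then A $ i else B $ i) $ i $ p i)" for p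
    by (simp add: prod_add prod.If_cases if_distrib[of "\<lambda>v. v $ _"] Compl_eq_Diff_UNIV cong: if_cong)
  then show ?thesis
    unfolding det_def by (simp add: sum_distrib_left sum.swap[of _ UNIV])
qed

text \<open>
  Every row of \<open>X - A\<close> is a sum of a row of \<open>- A\<close> and \<open>X\<close> times a unit vector.  Expanding the
  determinant row by row and pulling out the scalars leaves one principal minor for each set of rows
  taken from \<open>A\<close>.
\<close>
lemma charpoly_eq_sum_principal_minors:
  fixes A :: "'a::comm_ring_1^'n^'n"
  shows "charpoly A =
    (\<Sum>I\<in>UNIV. monom ((- 1) ^ card I * principal_minor I A) (CARD('n) - card I))"
proof -
  let ?A = "map_matrix (\<lambda>a. [:a:]) A"
  have "charpoly A = det ((- ?A) + mat [:0, 1:])"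
    by (simp add: charpoly_def)
  also have "\<dots> = (\<Sum>I\<in>UNIV. det (\<chi> i. if i \<in> I then (- ?A) $ i else mat [:0, 1:] $ i))"
    by (rule det_add_expand_rows)
  also have "\<dots> = (\<Sum>I\<in>UNIV. monom ((- 1) ^ card I * principal_minor I A) (CARD('n) - card I))"
  proof (rule sum.cong[OF refl])
    fix I :: "'n set"
    have "det (\<chi> i. if i \<in> I then (- ?A) $ i else mat [:0, 1:] $ i) =
        det (\<chi> i. (if i \<in> I then - 1 else [:0, 1:]) *s (if i \<in> I then ?A $ i else axis i 1))"
      by (rule arg_cong[of _ _ det]) (simp add: vec_eq_iff mat_def axis_def)
    also have "\<dots> = (\<Prod>i\<in>UNIV. if i \<in> I then - 1 else [:0, 1:]) * principal_minor I ?A"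
      by (simp add: det_rows_mul principal_minor_def)
    also have "principal_minor I ?A = [:principal_minor I A:]"
      by (rule principal_minor_map_matrix_hom) (simp_all)
    also have "(\<Prod>i\<in>UNIV. if i \<in> I then - 1 else [:0, 1:]) =
        (- 1 :: 'a poly) ^ card I * [:0, 1:] ^ (CARD('n) - card I)"
      by (simp add: prod.If_cases Compl_eq_Diff_UNIV card_Diff_subset flip: Compl_eq)
    also have "\<dots> * [:principal_minor I A:] =
        monom ((- 1) ^ card I * principal_minor I A) (CARD('n) - card I)"
    proof -
      have "(- 1 :: 'a poly) ^ m = [:(- 1) ^ m:]" for m
        by (induction m) simp_all
      then show ?thesis
        by (simp add: monom_altdef mult.commute)
    qed
    finally show "det (\<chi> i. if i \<in> I then (- ?A) $ i else mat [:0, 1:] $ i) =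
        monom ((- 1) ^ card I * principal_minor I A) (CARD('n) - card I)" .
  qed
  finally show ?thesis .
qed

lemma coeff_charpoly:
  fixes A :: "'a::comm_ring_1^'n^'n"
  assumes "k \<le> CARD('n)"
  shows "coeff (charpoly A) (CARD('n) - k) =
    (- 1) ^ k * (\<Sum>I | card I = k. principal_minor I A)"
proof -
  have eq: "CARD('n) - card I = CARD('n) - k \<longleftrightarrow> card I = k" for I :: "'n set"
    using assms card_mono[of UNIV I] by auto
  show ?thesis
    by (simp add: charpoly_eq_sum_principal_minors coeff_sum eq sum.If_cases sum_distrib_left
        Int_def cong: if_cong)
qed

lemma charpoly_diagonal:
  fixes lam :: "'a::comm_ring_1^'n"
  shows "charpoly (\<chi> i j. if i = j then lam $ i else 0) = (\<Prod>i\<in>UNIV. [:- (lam $ i), 1:])"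
  unfolding charpoly_def by (subst det_diagonal) (simp_all add: mat_def)

lemma principal_minor_diagonal:
  fixes lam :: "'a::comm_ring_1^'n"
  shows "principal_minor I (\<chi> i j. if i = j then lam $ i else 0) = (\<Prod>i\<in>I. lam $ i)"
  unfolding principal_minor_def
  by (subst det_diagonal) (auto simp: axis_def prod.If_cases if_distrib[of "\<lambda>v. v $ _"] cong: if_cong)

text \<open>
  Both sides are, up to the same sign, the coefficient of \<open>X ^ (n - k)\<close> of one polynomial: it is
  the characteristic polynomial of \<open>A\<close> and also that of the diagonal matrix of the \<open>lam $ i\<close>, whose
  principal minors are the products over the index sets.
\<close>
lemma sigma_eq_sum_principal_minors:
  fixes A :: "'a::comm_ring_1^'n^'n" and lam :: "'a^'n"
  assumes "charpoly A = (\<Prod>i\<in>UNIV. [:- (lam $ i), 1:])"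
  shows "sigma k lam = (\<Sum>I | card I = k. principal_minor I A)"
proof (cases "k \<le> CARD('n)")
  case True
  have "(- 1) ^ k * (\<Sum>I | card I = k. principal_minor I A) = (- 1) ^ k * sigma k lam"
    using coeff_charpoly[OF True, of A]
      coeff_charpoly[OF True, of "\<chi> i j. if i = j then lam $ i else 0"]
    by (simp add: assms charpoly_diagonal principal_minor_diagonal sigma_def)
  then have "(- 1) ^ k * ((- 1) ^ k * (\<Sum>I | card I = k. principal_minor I A)) =
      (- 1) ^ k * ((- 1) ^ k * sigma k lam)"
    by simp
  then show ?thesis
    by (simp flip: mult.assoc power_mult_distrib)
next
  case False
  then have "{I :: 'n set. card I = k} = {}"
    using card_mono[of "UNIV :: 'n set"] by fastforce
  then show ?thesis
    by (simp add: sigma_def)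
qed

text \<open>
  The polynomial is monic of degree \<open>n\<close> and splits over the algebraically closed field of complex
  numbers, so its roots can be listed along the index type; hence the choice in \<open>eigvals\<close> succeeds.
\<close>
lemma eigvals_complex:
  fixes A :: "complex^'n^'n"
  shows "charpoly A = (\<Prod>i\<in>UNIV. [:- (eigvals A $ i), 1:])"
proof -
  let ?n = "CARD('n)"
  have coeff_eq: "coeff (charpoly A) m =
      (\<Sum>I\<in>UNIV. if ?n - card I = m then (- 1) ^ card I * principal_minor I A else 0)" for m
    by (simp add: charpoly_eq_sum_principal_minors coeff_sum)
  have lead: "coeff (charpoly A) ?n = 1"
  proof -
    have "(\<chi> i. axis i 1) = (mat 1 :: complex^'n^'n)"
      by (simp add: vec_eq_iff mat_def axis_def)
    then show ?thesis
      using coeff_charpoly[of 0 A] by (simp add: principal_minor_def)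
  qed
  have "degree (charpoly A) \<le> ?n"
    by (rule degree_le) (auto simp: coeff_eq intro!: sum.neutral)
  then have deg: "degree (charpoly A) = ?n"
    using lead le_degree[of "charpoly A" ?n] by simp
  obtain M where M: "size M = ?n" "charpoly A = (\<Prod>x\<in>#M. [:- x, 1:])"
    using alg_closed_imp_factorization[of "charpoly A"] lead deg by fastforce
  obtain xs where xs: "mset xs = M"
    using ex_mset by blast
  obtain f :: "'n \<Rightarrow> nat" where f: "bij_betw f UNIV {0..<?n}"
    using ex_bij_betw_finite_nat[of "UNIV :: 'n set"] by auto
  have len: "length xs = ?n"
    using M(1) xs by auto
  have "charpoly A = (\<Prod>j = 0..<?n. [:- (xs ! j), 1:])"
    unfolding M(2) xs[symmetric] mset_map[symmetric] prod_mset_prod_list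
    by (simp add: prod.list_conv_set_nth len)
  also have "\<dots> = (\<Prod>i\<in>UNIV. [:- (xs ! f i), 1:])"
    by (rule prod.reindex_bij_betw[OF f, symmetric])
  finally have "charpoly A = (\<Prod>i\<in>UNIV. [:- ((\<chi> i. xs ! f i) $ i), 1:])"
    by simp
  then show ?thesis
    unfolding eigvals_def by (rule someI)
qed

lemma S_eq_sum_principal_minors: "S k R = (\<Sum>I | card I = k. principal_minor I R)"
proof -
  have "principal_minor I (map_matrix complex_of_real R) = complex_of_real (principal_minor I R)" for I
    by (rule principal_minor_map_matrix_hom) simp_all
  then show ?thesis
    by (simp add: S_def sigma_eq_sum_principal_minors[OF eigvals_complex])
qed

lemma principal_minor_scaleR:
  fixes R :: "real^'n^'n"
  shows "principal_minor I (c *\<^sub>R R) = c ^ card I * principal_minor I R"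
proof -
  have "principal_minor I (c *\<^sub>R R) =
      det (\<chi> i. (if i \<in> I then c else 1) *s (if i \<in> I then R $ i else axis i 1))"
    unfolding principal_minor_def
    by (rule arg_cong[of _ _ det]) (simp add: vec_eq_iff)
  then show ?thesis
    by (simp add: det_rows_mul principal_minor_def prod.If_cases)
qed

lemma S_scaleR: "S k (c *\<^sub>R R) = c ^ k * S k R"
  by (simp add: S_eq_sum_principal_minors principal_minor_scaleR sum_distrib_left)

lemma polynomial_principal_minor:
  "real_polynomial_function (\<lambda>R :: real^'n^'n. principal_minor I R)"
proof -
  have entry: "real_polynomial_function (\<lambda>R :: real^'n^'n. (if i \<in> I then R $ i else axis i 1) $ j)" for i j
    by (cases "i \<in> I")
      (simp_all add: real_polynomial_function.intros(1,2) bounded_linear_compose[OF bounded_linear_vec_nth]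
        bounded_linear_vec_nth)
  show ?thesis
    unfolding principal_minor_def det_def
    by (intro real_polynomial_function_sum real_polynomial_function_prod
        real_polynomial_function.intros(2,4))
      (simp_all add: entry finite_permutations)
qed

lemma polynomial_S: "real_polynomial_function (\<lambda>R :: real^'n^'n. S k R)"
  unfolding S_eq_sum_principal_minors
  by (intro real_polynomial_function_sum) (simp_all add: polynomial_principal_minor)

text \<open>
  If the matrix defining the minor kills \<open>x\<close>, then for each \<open>i\<close> either \<open>x $ i\<close> or \<open>(R *v x) $ i\<close>
  vanishes, and so does \<open>x \<bullet> (R *v x)\<close>.
\<close>
lemma principal_minor_nonzero:
  fixes R :: "real^'n^'n"
  assumes pos: "\<And>x. x \<noteq> 0 \<Longrightarrow> 0 < x \<bullet> (R *v x)"
  shows "principal_minor I R \<noteq> 0"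
proof -
  let ?B = "\<chi> i. if i \<in> I then R $ i else axis i 1"
  have "x = 0" if Bx: "?B *v x = 0" for x
  proof (rule ccontr)
    assume "x \<noteq> 0"
    have "x $ i * (R *v x) $ i = 0" for i
    proof (cases "i \<in> I")
      case True
      then have "(R *v x) $ i = (?B *v x) $ i"
        by (simp add: matrix_vector_mult_def)
      then show ?thesis
        by (simp add: Bx)
    next
      case False
      then have "x $ i = (?B *v x) $ i"
        by (simp add: matrix_vector_mult_def axis_def if_distrib[of "\<lambda>c. c * _"] cong: if_cong)
      then show ?thesis
        by (simp add: Bx)
    qed
    then have "x \<bullet> (R *v x) = 0"
      unfolding inner_vec_def by (intro sum.neutral) simp
    with pos[OF \<open>x \<noteq> 0\<close>] show False
      by simp
  qed
  then have "invertible ?B"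
    by (simp add: invertible_left_inverse matrix_left_invertible_ker)
  then show ?thesis
    by (simp add: principal_minor_def invertible_det_nz)
qed

text \<open>
  Positivity of the quadratic form persists along the segment from the identity to \<open>R\<close>, so by the
  preceding lemma the minor does not vanish there; at the identity it equals one.
\<close>
lemma principal_minor_pos:
  fixes R :: "real^'n^'n"
  assumes pos: "\<And>x. x \<noteq> 0 \<Longrightarrow> 0 < x \<bullet> (R *v x)"
  shows "0 < principal_minor I R"
proof (rule ccontr)
  assume neg: "\<not> 0 < principal_minor I R"
  let ?R = "\<lambda>t. (1 - t) *\<^sub>R mat 1 + t *\<^sub>R R"
  have "principal_minor I (mat 1 :: real^'n^'n) = 1"
  proof -
    have "(\<chi> i. if i \<in> I then (mat 1 :: real^'n^'n) $ i else axis i 1) = mat 1"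
      by (simp add: vec_eq_iff mat_def axis_def)
    then show ?thesis
      by (simp add: principal_minor_def)
  qed
  then have "0 \<le> principal_minor I (?R 0)" "principal_minor I (?R 1) \<le> 0"
    using neg by simp_all
  moreover have "continuous_on {0..1} (\<lambda>t. principal_minor I (?R t))"
    using continuous_on_polymonial_function[of "principal_minor I :: real^'n^'n \<Rightarrow> real"]
    by (intro continuous_on_compose2[of UNIV "principal_minor I" _ ?R] continuous_intros)
      (simp_all add: polynomial_principal_minor flip: real_polynomial_function_eq)
  ultimately obtain t where t: "0 \<le> t" "t \<le> 1" "principal_minor I (?R t) = 0"
    using IVT2'[of "\<lambda>t. principal_minor I (?R t)" 1 0 0] by auto
  have "0 < x \<bullet> (?R t *v x)" if "x \<noteq> 0" for x
  proof -
    have "x \<bullet> (?R t *v x) = (1 - t) * (x \<bullet> x) + t * (x \<bullet> (R *v x))"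
      by (simp add: matrix_vector_mult_add_rdistrib scaleR_matrix_vector_assoc[symmetric]
          inner_add_right)
    moreover have "0 < x \<bullet> x" "0 < x \<bullet> (R *v x)"
      using that pos by simp_all
    ultimately show ?thesis
      using t(1,2)
      by (cases "t = 0") (simp_all add: add_nonneg_pos)
  qed
  from principal_minor_nonzero[of "?R t", OF this] t(3) show False
    by blast
qed

lemma S_pos:
  fixes R :: "real^'n^'n"
  assumes "\<And>x. x \<noteq> 0 \<Longrightarrow> 0 < x \<bullet> (R *v x)" and "k \<le> CARD('n)"
  shows "0 < S k R"
proof -
  obtain I :: "'n set" where "card I = k"
    using obtain_subset_with_card_n[OF assms(2)] by auto
  then show ?thesis
    unfolding S_eq_sum_principal_minors
    by (intro sum_pos) (auto intro: principal_minor_pos assms(1))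
qed

section \<open>Second partial derivatives of the logarithm\<close>

lemma polynomial_directional_derivative:
  assumes "real_polynomial_function p"
  shows "\<exists>q. real_polynomial_function q \<and>
    (\<forall>x. ((\<lambda>t. p (x + t *\<^sub>R v)) has_real_derivative q x) (at 0))"
  using assms
proof (induction p rule: real_polynomial_function.induct)
  case (linear f)
  interpret f: bounded_linear f by fact
  have "((\<lambda>t. f (x + t *\<^sub>R v)) has_real_derivative f v) (at 0)" for x
    by (auto simp: f.add f.scaleR intro!: derivative_eq_intros)
  then show ?case
    by (intro exI[of _ "\<lambda>x. f v"]) (simp add: real_polynomial_function.intros(2))
next
  case (const c)
  then show ?case
    by (intro exI[of _ "\<lambda>x. 0"]) (simp add: real_polynomial_function.intros(2))
next
  case (add f g)
  then obtain f' g' where "real_polynomial_function f'" "real_polynomial_function g'"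
    and deriv: "\<And>x. ((\<lambda>t. f (x + t *\<^sub>R v)) has_real_derivative f' x) (at 0)"
      "\<And>x. ((\<lambda>t. g (x + t *\<^sub>R v)) has_real_derivative g' x) (at 0)"
    by blast
  then have "real_polynomial_function (\<lambda>x. f' x + g' x)"
    by (intro real_polynomial_function.intros(3))
  then show ?case
    using DERIV_add[OF deriv] by blast
next
  case (mult f g)
  then obtain f' g' where "real_polynomial_function f'" "real_polynomial_function g'"
    and deriv: "\<And>x. ((\<lambda>t. f (x + t *\<^sub>R v)) has_real_derivative f' x) (at 0)"
      "\<And>x. ((\<lambda>t. g (x + t *\<^sub>R v)) has_real_derivative g' x) (at 0)"
    by blast
  with mult.hyps have "real_polynomial_function (\<lambda>x. f' x * g x + g' x * f x)"
    by (intro real_polynomial_function.intros(3,4))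
  moreover have "((\<lambda>t. f (x + t *\<^sub>R v) * g (x + t *\<^sub>R v)) has_real_derivative
      f' x * g x + g' x * f x) (at 0)" for x
    using DERIV_mult[OF deriv, of x x] by simp
  ultimately show ?case
    by blast
qed

lemma continuous_on_real_polynomial_function:
  "real_polynomial_function p \<Longrightarrow> continuous_on A p"
  by (simp add: continuous_on_polymonial_function real_polynomial_function_eq)

lemma entry_deriv_eqI:
  "((\<lambda>t. f (R + t *\<^sub>R axis i (axis j 1))) has_real_derivative d) (at 0) \<Longrightarrow> entry_deriv i j f R = d"
  unfolding entry_deriv_def by (rule DERIV_imp_deriv)

lemma polynomial_entry_deriv:
  fixes p :: "real^'n^'n \<Rightarrow> real"
  assumes "real_polynomial_function p"
  shows "real_polynomial_function (entry_deriv i j p)"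
    and "((\<lambda>t. p (R + t *\<^sub>R axis i (axis j 1))) has_real_derivative entry_deriv i j p R) (at 0)"
proof -
  obtain q where q: "real_polynomial_function q"
    "\<And>R. ((\<lambda>t. p (R + t *\<^sub>R axis i (axis j 1))) has_real_derivative q R) (at 0)"
    using polynomial_directional_derivative[OF assms] by blast
  then have "entry_deriv i j p = q"
    by (intro ext entry_deriv_eqI)
  with q show "real_polynomial_function (entry_deriv i j p)"
    "((\<lambda>t. p (R + t *\<^sub>R axis i (axis j 1))) has_real_derivative entry_deriv i j p R) (at 0)"
    by simp_all
qed

lemma has_derivative_along_cong_open:
  fixes R E :: "'a::real_normed_vector" and f g :: "'a \<Rightarrow> real"
  assumes "((\<lambda>t. g (R + t *\<^sub>R E)) has_real_derivative d) (at 0)"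
    and "open U" "R \<in> U" "\<And>X. X \<in> U \<Longrightarrow> f X = g X"
  shows "((\<lambda>t. f (R + t *\<^sub>R E)) has_real_derivative d) (at 0)"
proof -
  have "((\<lambda>t. R + t *\<^sub>R E) \<longlongrightarrow> R + 0 *\<^sub>R E) (nhds 0)"
    by (intro tendsto_intros filterlim_ident)
  then have "\<forall>\<^sub>F t in nhds 0. R + t *\<^sub>R E \<in> U"
    using assms(2,3) by (auto dest: topological_tendstoD)
  then have "\<forall>\<^sub>F t in nhds 0. f (R + t *\<^sub>R E) = g (R + t *\<^sub>R E)"
    by eventually_elim (simp add: assms(4))
  then show ?thesis
    using assms(1) by (simp add: DERIV_cong_ev)
qed

text \<open>
  The chain rule for \<open>X \<mapsto> c X\<close>.  A homogeneity law is required only near \<open>R\<close>, because the laws for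
  \<open>F k\<close> hold only where \<open>S k\<close> is positive; the additive constant accounts for the logarithm.
\<close>
lemma entry_deriv_scaleR:
  assumes "0 < c" and "open U" "R \<in> U"
    and scale: "\<And>X. X \<in> U \<Longrightarrow> f (c *\<^sub>R X) = a + b * f X"
    and deriv: "((\<lambda>t. f (R + t *\<^sub>R axis i (axis j 1))) has_real_derivative d) (at 0)"
  shows "entry_deriv i j f (c *\<^sub>R R) = b * d / c"
proof (rule entry_deriv_eqI, rule has_derivative_along_cong_open)
  let ?g = "\<lambda>X. a + b * f (X /\<^sub>R c)"
  have "((\<lambda>t. f (R + (t / c) *\<^sub>R axis i (axis j 1))) has_real_derivative d * (1 / c)) (at 0)"
    using deriv assms(1)
    by (intro DERIV_chain2[of "\<lambda>t. f (R + t *\<^sub>R axis i (axis j 1))"])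
      (auto intro!: derivative_eq_intros)
  then have "((\<lambda>t. a + b * f (R + (t / c) *\<^sub>R axis i (axis j 1))) has_real_derivative b * d / c) (at 0)"
    by (auto intro!: derivative_eq_intros)
  moreover have "(c *\<^sub>R R + t *\<^sub>R axis i (axis j 1)) /\<^sub>R c = R + (t / c) *\<^sub>R axis i (axis j 1)" for t
    using assms(1) by (simp add: scaleR_add_right divide_inverse mult.commute)
  ultimately show "((\<lambda>t. ?g (c *\<^sub>R R + t *\<^sub>R axis i (axis j 1))) has_real_derivative b * d / c) (at 0)"
    by simp
  show "open ((*\<^sub>R) c ` U)"
    using assms(1,2) by (simp add: open_scaling)
  show "c *\<^sub>R R \<in> (*\<^sub>R) c ` U"
    using assms(3) by blast
  show "f X = ?g X" if "X \<in> (*\<^sub>R) c ` U" for X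
    using that assms(1) scale by auto
qed

lemma open_S_pos: "open {R. 0 < S k R}"
  by (intro open_Collect_less continuous_on_real_polynomial_function polynomial_S continuous_intros)

text \<open>
  Where \<open>S k\<close> is positive, the partial derivatives of \<open>F k\<close> are given by the usual quotients of
  polynomials.  This set is open, so the quotient for the first derivative may be differentiated again.
\<close>
lemma F_partial_derivatives:
  fixes R :: "real^'n^'n"
  shows has_entry_deriv_F: "0 < S k R \<Longrightarrow>
      ((\<lambda>t. F k (R + t *\<^sub>R axis l (axis m 1))) has_real_derivative entry_deriv l m (F k) R) (at 0)"
    and has_second_entry_deriv_F: "0 < S k R \<Longrightarrow>
      ((\<lambda>t. entry_deriv l m (F k) (R + t *\<^sub>R axis i (axis j 1))) has_real_derivative
        entry_deriv i j (entry_deriv l m (F k)) R) (at 0)"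
    and continuous_second_entry_deriv_F:
      "continuous_on {R :: real^'n^'n. 0 < S k R} (entry_deriv i j (entry_deriv l m (F k)))"
proof -
  define D where "D l m = entry_deriv l m (S k :: real^'n^'n \<Rightarrow> real)" for l m
  define D2 where "D2 i j l m = entry_deriv i j (D l m)" for i j l m
  have D: "real_polynomial_function (D l m)"
    "((\<lambda>t. S k (R + t *\<^sub>R axis l (axis m 1))) has_real_derivative D l m R) (at 0)" for l m R
    using polynomial_entry_deriv[OF polynomial_S] by (simp_all add: D_def)
  have D2: "real_polynomial_function (D2 i j l m)"
    "((\<lambda>t. D l m (R + t *\<^sub>R axis i (axis j 1))) has_real_derivative D2 i j l m R) (at 0)"
    for i j l m R
    using polynomial_entry_deriv[OF D(1)] by (simp_all add: D2_def)
  have first: "((\<lambda>t. F k (R + t *\<^sub>R axis l (axis m 1))) has_real_derivative D l m R / S k R) (at 0)"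
    if "0 < S k R" for R :: "real^'n^'n" and l m
    unfolding F_def using that by (auto intro!: derivative_eq_intros D(2))
  have first_eq: "entry_deriv l m (F k) R = D l m R / S k R" if "0 < S k R" for R :: "real^'n^'n" and l m
    by (rule entry_deriv_eqI[OF first[OF that]])
  have second: "((\<lambda>t. entry_deriv l m (F k) (R + t *\<^sub>R axis i (axis j 1))) has_real_derivative
      (D2 i j l m R * S k R - D l m R * D i j R) / (S k R * S k R)) (at 0)"
    if "0 < S k R" for R :: "real^'n^'n" and i j l m
  proof (rule has_derivative_along_cong_open[OF _ open_S_pos[of k]])
    show "((\<lambda>t. D l m (R + t *\<^sub>R axis i (axis j 1)) / S k (R + t *\<^sub>R axis i (axis j 1)))
        has_real_derivative (D2 i j l m R * S k R - D l m R * D i j R) / (S k R * S k R)) (at 0)"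
      using DERIV_divide[OF D2(2) D(2)] that by simp
  qed (simp_all add: that first_eq)
  have second_eq: "entry_deriv i j (entry_deriv l m (F k)) R =
      (D2 i j l m R * S k R - D l m R * D i j R) / (S k R * S k R)" if "0 < S k R" for R :: "real^'n^'n" and i j l m
    by (rule entry_deriv_eqI[OF second[OF that]])
  show "((\<lambda>t. F k (R + t *\<^sub>R axis l (axis m 1))) has_real_derivative entry_deriv l m (F k) R) (at 0)"
    if "0 < S k R"
    using first[OF that] first_eq[OF that] by simp
  show "((\<lambda>t. entry_deriv l m (F k) (R + t *\<^sub>R axis i (axis j 1))) has_real_derivative
        entry_deriv i j (entry_deriv l m (F k)) R) (at 0)" if "0 < S k R"
    using second[OF that] second_eq[OF that] by simp
  have "continuous_on {R. 0 < S k R}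
      (\<lambda>R. (D2 i j l m R * S k R - D l m R * D i j R) / (S k R * S k R))"
    by (intro continuous_intros continuous_on_real_polynomial_function D(1) D2(1) polynomial_S) simp
  then show "continuous_on {R :: real^'n^'n. 0 < S k R} (entry_deriv i j (entry_deriv l m (F k)))"
    by (rule continuous_on_eq) (simp add: second_eq)
qed

text \<open>
  Since \<open>S k\<close> is homogeneous of degree \<open>k\<close>, its logarithm only gains the constant \<open>k * ln c\<close>; each
  differentiation then contributes one factor \<open>1 / c\<close>.
\<close>
lemma second_entry_deriv_F_scaleR:
  fixes R :: "real^'n^'n"
  assumes "0 < c" "0 < S k R"
  shows "entry_deriv i j (entry_deriv l m (F k)) (c *\<^sub>R R) =
    entry_deriv i j (entry_deriv l m (F k)) R / c\<^sup>2"
proof -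
  have F: "F k (c *\<^sub>R X) = real k * ln c + 1 * F k X" if "0 < S k X" for X :: "real^'n^'n"
    using assms(1) that by (simp add: F_def S_scaleR ln_mult ln_realpow)
  have "entry_deriv l m (F k) (c *\<^sub>R X) = 0 + 1 / c * entry_deriv l m (F k) X" if "0 < S k X" for X :: "real^'n^'n"
    using entry_deriv_scaleR[where a = "real k * ln c" and b = 1,
        OF assms(1) open_S_pos _ _ has_entry_deriv_F[OF that, of l m]] F that by simp
  then show ?thesis
    using entry_deriv_scaleR[where a = 0 and b = "1 / c",
        OF assms(1) open_S_pos _ _ has_second_entry_deriv_F[OF assms(2), of l m i j]] assms(2)
    by (simp add: power2_eq_square)
qed

text \<open>
  The bilinear form whose diagonal is \<open>d2F\<close>.
\<close>
definition hessian_form :: "nat \<Rightarrow> real^'n^'n \<Rightarrow> real^'n^'n \<Rightarrow> real^'n^'n \<Rightarrow> real" where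
  "hessian_form k R M N = (\<Sum>i\<in>UNIV. \<Sum>j\<in>UNIV. \<Sum>l\<in>UNIV. \<Sum>m\<in>UNIV.
     entry_deriv i j (entry_deriv l m (F k)) R * M $ i $ j * N $ l $ m)"

lemma d2F_add:
  "d2F k R (P + Q) = d2F k R P + (hessian_form k R P Q + hessian_form k R Q P) + hessian_form k R Q Q"
  by (simp add: d2F_def hessian_form_def algebra_simps sum.distrib)

lemma compact_coercive_matrices:
  "compact {R :: real^'n^'n. norm R \<le> r \<and> (\<forall>x. x \<bullet> x \<le> x \<bullet> (R *v x))}"
proof -
  have cont: "continuous_on UNIV (\<lambda>R :: real^'n^'n. x \<bullet> (R *v x))" for x
    unfolding matrix_vector_mult_def inner_vec_def by (auto intro!: continuous_intros)
  have "closed {R :: real^'n^'n. x \<bullet> x \<le> x \<bullet> (R *v x)}" for x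
    by (intro closed_Collect_le cont continuous_intros)
  then have "closed (\<Inter>x. {R :: real^'n^'n. x \<bullet> x \<le> x \<bullet> (R *v x)})"
    by blast
  then have "compact (cball 0 r \<inter> (\<Inter>x. {R :: real^'n^'n. x \<bullet> x \<le> x \<bullet> (R *v x)}))"
    by (intro compact_Int_closed compact_cball)
  moreover have "cball 0 r \<inter> (\<Inter>x. {R :: real^'n^'n. x \<bullet> x \<le> x \<bullet> (R *v x)}) =
      {R. norm R \<le> r \<and> (\<forall>x. x \<bullet> x \<le> x \<bullet> (R *v x))}"
    by auto
  ultimately show ?thesis
    by simp
qed

lemma abs_entry_le_norm: "\<bar>A $ i $ j\<bar> \<le> norm (A :: real^'n^'m)"
  by (rule order_trans[OF component_le_norm_cart Finite_Cartesian_Product.norm_nth_le])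

text \<open>
  Rescaling by \<open>s\<close> moves \<open>R\<close> into a fixed compact set of matrices with positive definite symmetric
  part, on which the second partial derivatives are continuous and hence bounded; scaling back costs
  the factor \<open>1 / s ^ 2\<close>.
\<close>
lemma hessian_form_bound:
  assumes "k \<le> CARD('n)"
  shows "\<exists>K > 0. \<forall>(R :: real^'n^'n) M N s. 0 < s \<longrightarrow> norm R \<le> r * s \<longrightarrow>
    (\<forall>x. s * (x \<bullet> x) \<le> x \<bullet> (R *v x)) \<longrightarrow>
    \<bar>hessian_form k R M N\<bar> \<le> K * norm M * norm N / s\<^sup>2"
proof -
  let ?K = "{R :: real^'n^'n. norm R \<le> r \<and> (\<forall>x. x \<bullet> x \<le> x \<bullet> (R *v x))}"
  let ?a = "\<lambda>i j l m. entry_deriv i j (entry_deriv l m (F k)) :: real^'n^'n \<Rightarrow> real"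
  have S: "0 < S k R" if "R \<in> ?K" for R
  proof (rule S_pos[OF _ assms])
    fix x :: "real^'n" assume "x \<noteq> 0"
    then have "0 < x \<bullet> x"
      by simp
    also have "\<dots> \<le> x \<bullet> (R *v x)"
      using that by simp
    finally show "0 < x \<bullet> (R *v x)" .
  qed
  have ex_bound: "\<exists>B. \<forall>R \<in> ?K. \<bar>?a i j l m R\<bar> \<le> B" for i j l m
  proof -
    have "continuous_on ?K (?a i j l m)"
      using S by (intro continuous_on_subset[OF continuous_second_entry_deriv_F]) blast
    then have "bounded (?a i j l m ` ?K)"
      by (intro compact_imp_bounded compact_continuous_image compact_coercive_matrices)
    then show ?thesis
      unfolding bounded_iff by auto
  qed
  define B where "B i j l m = (SOME B. \<forall>R \<in> ?K. \<bar>?a i j l m R\<bar> \<le> B)" for i j l m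
  have B: "\<bar>?a i j l m R\<bar> \<le> B i j l m" if "R \<in> ?K" for i j l m R
    using someI_ex[OF ex_bound, of i j l m] that unfolding B_def by blast
  let ?T = "\<Sum>i\<in>UNIV. \<Sum>j\<in>UNIV. \<Sum>l\<in>UNIV. \<Sum>m\<in>UNIV. \<bar>B i j l m\<bar>"
  have "\<bar>hessian_form k R M N\<bar> \<le> (1 + ?T) * norm M * norm N / s\<^sup>2"
    if s: "0 < s" and R: "norm R \<le> r * s" "\<forall>x. s * (x \<bullet> x) \<le> x \<bullet> (R *v x)"
    for R M N :: "real^'n^'n" and s
  proof -
    have RK: "R /\<^sub>R s \<in> ?K"
      using s R by (simp add: scaleR_matrix_vector_assoc[symmetric] field_simps)
    have bound: "\<bar>?a i j l m R\<bar> \<le> \<bar>B i j l m\<bar> / s\<^sup>2" for i j l m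
    proof -
      have "?a i j l m R = ?a i j l m (R /\<^sub>R s) / s\<^sup>2"
        using second_entry_deriv_F_scaleR[OF s S[OF RK], of i j l m] s by simp
      moreover have "\<bar>?a i j l m (R /\<^sub>R s)\<bar> \<le> \<bar>B i j l m\<bar>"
        using B[OF RK, of i j l m] by linarith
      ultimately show ?thesis
        by (simp add: divide_right_mono)
    qed
    have "\<bar>hessian_form k R M N\<bar> \<le> (\<Sum>i\<in>UNIV. \<Sum>j\<in>UNIV. \<Sum>l\<in>UNIV. \<Sum>m\<in>UNIV.
        \<bar>B i j l m\<bar> / s\<^sup>2 * norm M * norm N)"
      unfolding hessian_form_def
      by (intro order_trans[OF sum_abs] sum_mono, unfold abs_mult,
          intro mult_mono bound abs_entry_le_norm) simp_all
    also have "\<dots> = ?T * norm M * norm N / s\<^sup>2"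
      by (simp add: sum_distrib_right sum_divide_distrib)
    also have "\<dots> \<le> (1 + ?T) * norm M * norm N / s\<^sup>2"
      by (intro divide_right_mono mult_right_mono) simp_all
    finally show ?thesis .
  qed
  moreover have "0 < 1 + ?T"
    by (intro add_pos_nonneg sum_nonneg) simp_all
  ultimately show ?thesis
    by blast
qed

section \<open>Orthogonal diagonalization of symmetric matrices\<close>

text \<open>
  A unit vector of \<open>V\<close> that maximizes the quadratic form \<open>x \<bullet> f x\<close> is an eigenvector: the defect
  \<open>h x = c * (x \<bullet> x) - x \<bullet> f x\<close> is nonnegative on \<open>V\<close> and vanishes at that vector, so its first
  variation there, in the direction of \<open>c *\<^sub>R v - f v\<close>, has to vanish as well.
\<close>
lemma eigenvector_in_invariant_subspace:
  fixes f :: "'a::euclidean_space \<Rightarrow> 'a"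
  assumes "linear f" and V: "subspace V" "V \<noteq> {0}" and inv: "f ` V \<subseteq> V"
    and self_adjoint: "\<And>x y. f x \<bullet> y = x \<bullet> f y"
  obtains v c where "v \<in> V" "norm v = 1" "f v = c *\<^sub>R v"
proof -
  interpret linear f by fact
  let ?K = "sphere 0 1 \<inter> V"
  have "compact ?K"
    using V by (intro compact_Int_closed closed_subspace) simp_all
  moreover have "?K \<noteq> {}"
  proof -
    obtain x where "x \<in> V" "x \<noteq> 0"
      using V subspace_0[of V] by blast
    then have "x /\<^sub>R norm x \<in> ?K"
      using V by (simp add: subspace_scale)
    then show ?thesis
      by blast
  qed
  moreover have "continuous_on ?K (\<lambda>x. x \<bullet> f x)"
    by (intro continuous_intros linear_continuous_on_compose[OF _ \<open>linear f\<close>])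
  ultimately obtain v where v: "v \<in> ?K" and max: "\<And>x. x \<in> ?K \<Longrightarrow> x \<bullet> f x \<le> v \<bullet> f v"
    using continuous_attains_sup[of ?K] by metis
  define c where "c = v \<bullet> f v"
  define h where "h x = c * (x \<bullet> x) - x \<bullet> f x" for x
  have vv: "v \<bullet> v = 1"
    using v by (simp add: norm_eq_1)
  have h_nonneg: "0 \<le> h x" if "x \<in> V" for x
  proof (cases "x = 0")
    case False
    then have "x /\<^sub>R norm x \<in> ?K"
      using V that by (simp add: subspace_scale)
    from max[OF this] have "(x \<bullet> f x) / (norm x)\<^sup>2 \<le> c"
      by (simp add: c_def scale power2_eq_square field_simps)
    with False show ?thesis
      by (simp add: h_def divide_le_eq flip: power2_norm_eq_inner)
  qed (simp add: h_def zero)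
  define w where "w = c *\<^sub>R v - f v"
  have w: "w \<in> V"
    using V v inv by (auto simp: w_def intro!: subspace_diff subspace_scale)
  \<comment> \<open>nonnegative for all \<open>t\<close>, this polynomial cannot have a nonzero linear coefficient\<close>
  have expand: "h (v + t *\<^sub>R w) = 2 * t * (w \<bullet> w) + t\<^sup>2 * h w" for t
  proof -
    have "h v = 0"
      by (simp add: h_def c_def vv)
    moreover have "h (v + t *\<^sub>R w) = h v + 2 * t * (c * (v \<bullet> w) - f v \<bullet> w) + t\<^sup>2 * h w"
      using self_adjoint[of v w]
      by (simp add: h_def add scale inner_simps power2_eq_square algebra_simps inner_commute)
    moreover have "c * (v \<bullet> w) - f v \<bullet> w = w \<bullet> w"
      by (simp add: w_def inner_simps inner_commute[of "f v" v] algebra_simps)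
    ultimately show ?thesis
      by simp
  qed
  have "w \<bullet> w = 0"
  proof (rule ccontr)
    assume "w \<bullet> w \<noteq> 0"
    then have pos: "0 < w \<bullet> w"
      by (simp add: order_less_le)
    have nonneg: "0 \<le> 2 * t * (w \<bullet> w) + t\<^sup>2 * h w" for t
      using h_nonneg[of "v + t *\<^sub>R w"] V v w
      by (simp add: expand subspace_add subspace_scale)
    show False
    proof (cases "h w = 0")
      case True
      then show False
        using nonneg[of "- 1"] pos by simp
    next
      case False
      then have "0 < h w"
        using h_nonneg[OF w] by simp
      with nonneg[of "- (w \<bullet> w) / h w"] pos mult_pos_pos[OF pos pos] show False
        by (simp add: field_simps power2_eq_square)
    qed
  qed
  then have "f v = c *\<^sub>R v"
    by (simp add: w_def)
  with v show thesis
    by (intro that[of v c]) auto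
qed

text \<open>
  Splitting off one eigenvector leaves its orthogonal complement in \<open>V\<close>, which is again invariant
  because \<open>f\<close> is self-adjoint.
\<close>
lemma orthonormal_eigenbasis:
  fixes f :: "'a::euclidean_space \<Rightarrow> 'a"
  assumes "linear f" and self_adjoint: "\<And>x y. f x \<bullet> y = x \<bullet> f y"
    and "subspace V" and "f ` V \<subseteq> V"
  shows "\<exists>B. finite B \<and> card B = dim V \<and> B \<subseteq> V \<and> pairwise orthogonal B \<and>
    (\<forall>b\<in>B. norm b = 1 \<and> (\<exists>c. f b = c *\<^sub>R b))"
  using assms(3,4)
proof (induction "dim V" arbitrary: V)
  case 0
  then show ?case
    by (intro exI[of _ "{}"]) simp
next
  case (Suc m)
  have "V \<noteq> {0}"
    using Suc.hyps(2) by auto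
  then obtain v c where v: "v \<in> V" "norm v = 1" "f v = c *\<^sub>R v"
    using eigenvector_in_invariant_subspace[OF \<open>linear f\<close> Suc.prems(1) _ Suc.prems(2) self_adjoint]
    by metis
  let ?W = "{y \<in> V. v \<bullet> y = 0}"
  have "?W = {y \<in> V. \<forall>x \<in> span {v}. orthogonal x y}"
    by (auto simp: span_singleton orthogonal_def)
  moreover have "dim {y \<in> V. \<forall>x \<in> span {v}. orthogonal x y} + dim (span {v}) = dim V"
    using Suc.prems(1) v(1) span_minimal[of "{v}" V]
    by (intro dim_subspace_orthogonal_to_vectors) simp_all
  ultimately have "dim ?W + dim (span {v}) = dim V"
    by simp
  moreover have "dim (span {v}) = 1"
  proof -
    have "v \<noteq> 0"
      using v(2) by auto
    then show ?thesis
      by (simp add: dim_singleton)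
  qed
  ultimately have "m = dim ?W"
    using Suc.hyps(2) by simp
  moreover have "subspace ?W"
    using Suc.prems(1) unfolding subspace_def by (simp add: inner_simps)
  moreover have "f ` ?W \<subseteq> ?W"
  proof
    fix z assume "z \<in> f ` ?W"
    then obtain y where y: "y \<in> ?W" "z = f y"
      by blast
    have "v \<bullet> f y = f v \<bullet> y"
      by (simp add: self_adjoint)
    then show "z \<in> ?W"
      using y Suc.prems(2) by (auto simp: v(3))
  qed
  ultimately obtain B where B: "finite B" "card B = dim ?W" "B \<subseteq> ?W" "pairwise orthogonal B"
      "\<forall>b\<in>B. norm b = 1 \<and> (\<exists>c. f b = c *\<^sub>R b)"
    using Suc.hyps(1)[of ?W] by blast
  have orth: "v \<bullet> b = 0" if "b \<in> B" for b
    using B(3) that by blast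
  have "v \<notin> B"
    using orth[of v] v(2) by (auto simp: norm_eq_1)
  moreover have "pairwise orthogonal (insert v B)"
    using B(4) orth by (auto simp: pairwise_insert orthogonal_def inner_commute)
  moreover have "insert v B \<subseteq> V"
    using B(3) v(1) by blast
  ultimately show ?case
    using B v Suc.hyps(2) \<open>m = dim ?W\<close>
    by (intro exI[of _ "insert v B"]) auto
qed

lemma matrix_inv_orthogonal:
  fixes C :: "real^'n^'n"
  assumes "orthogonal_matrix C"
  shows "matrix_inv C = transpose C"
proof -
  have C: "transpose C ** C = mat 1" "C ** transpose C = mat 1"
    using assms by (simp_all add: orthogonal_matrix_def)
  then have "C ** matrix_inv C = mat 1 \<and> matrix_inv C ** C = mat 1"
    unfolding matrix_inv_def
    by (intro someI[of "\<lambda>B. C ** B = mat 1 \<and> B ** C = mat 1" "transpose C"] conjI)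
  then have "transpose C ** (C ** matrix_inv C) = transpose C"
    by (simp add: matrix_mul_rid)
  then show ?thesis
    by (simp add: matrix_mul_assoc C(1) matrix_mul_lid)
qed

lemma symmetric_mat_self_adjoint:
  assumes "symmetric_mat A"
  shows "(A *v x) \<bullet> y = x \<bullet> (A *v y)"
proof -
  have "(A *v x) \<bullet> y = (x v* transpose A) \<bullet> y"
    by (simp only: vector_transpose_matrix)
  also have "\<dots> = x \<bullet> (transpose A *v y)"
    by (rule dot_lmul_matrix)
  finally show ?thesis
    using assms unfolding symmetric_mat_def by (simp only:)
qed

lemma diag_mat_mult_left: "(diag_mat d ** A) $ i $ j = d $ i * A $ i $ j"
  by (simp add: matrix_matrix_mult_def diag_mat_def mult_delta_left)

lemma diag_mat_mult_right: "(A ** diag_mat d) $ i $ j = A $ i $ j * d $ j"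
  by (simp add: matrix_matrix_mult_def diag_mat_def mult_delta_right)

lemma symmetric_mat_diagonalizable:
  fixes A :: "real^'n^'n"
  assumes "symmetric_mat A"
  obtains C lam where "diagonalizes A C lam"
proof -
  obtain B where B: "finite B" "card B = CARD('n)" "pairwise orthogonal B"
      "\<And>b. b \<in> B \<Longrightarrow> norm b = 1 \<and> (\<exists>c. A *v b = c *\<^sub>R b)"
    using orthonormal_eigenbasis[of "(*v) A" UNIV] symmetric_mat_self_adjoint[OF assms]
    by auto
  then obtain b :: "'n \<Rightarrow> real^'n" where b: "bij_betw b UNIV B"
    using finite_same_card_bij[of "UNIV :: 'n set" B] by auto
  have b_in: "b i \<in> B" for i
    using b by (auto dest: bij_betwE)
  obtain c where c: "\<And>i. A *v b i = c i *\<^sub>R b i"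
    using B(4)[OF b_in] by metis
  define C where "C = (\<chi> i. b i)"
  have orth: "orthogonal (b i) (b j)" if "i \<noteq> j" for i j
  proof -
    have "b i \<noteq> b j"
      using b that by (auto simp: bij_betw_def dest: injD)
    then show ?thesis
      using B(3) b_in by (simp add: pairwise_def)
  qed
  have C: "orthogonal_matrix C"
    using B(4)[OF b_in] orth by (simp add: orthogonal_matrix_orthonormal_rows C_def row_def)
  have "(C ** A) $ i $ j = (diag_mat (vec_lambda c) ** C) $ i $ j" for i j
  proof -
    have "(C ** transpose A) $ i $ j = (A *v b i) $ j"
      by (simp add: C_def matrix_matrix_mult_def matrix_vector_mult_def transpose_def mult.commute)
    then show ?thesis
      using assms by (simp add: c diag_mat_mult_left C_def symmetric_mat_def)
  qed
  then have "C ** A = diag_mat (vec_lambda c) ** C"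
    by (simp add: vec_eq_iff)
  then have "transpose C ** (C ** A) = transpose C ** diag_mat (vec_lambda c) ** C"
    by (simp add: matrix_mul_assoc)
  then have "A = matrix_inv C ** diag_mat (vec_lambda c) ** C"
    using C by (simp add: matrix_mul_assoc matrix_inv_orthogonal matrix_mul_lid orthogonal_matrix_def)
  with C show thesis
    by (intro that[of C "vec_lambda c"]) (simp add: diagonalizes_def)
qed

lemma norm_matrix_sq: "(norm (A :: real^'n^'m))\<^sup>2 = (\<Sum>i\<in>UNIV. \<Sum>j\<in>UNIV. (A $ i $ j)\<^sup>2)"
proof -
  have "(norm A)\<^sup>2 = (\<Sum>i\<in>UNIV. A $ i \<bullet> A $ i)"
    by (simp only: power2_norm_eq_inner inner_vec_def)
  moreover have "x \<bullet> x = (\<Sum>j\<in>UNIV. (x $ j)\<^sup>2)" for x :: "real^'n"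
    by (simp only: inner_vec_def inner_real_def power2_eq_square)
  ultimately show ?thesis
    by simp
qed

lemma norm_transpose_matrix: "norm (transpose A) = norm (A :: real^'n^'m)"
proof -
  have "(norm (transpose A))\<^sup>2 = (norm A)\<^sup>2"
    unfolding norm_matrix_sq transpose_def by (subst sum.swap) simp
  then show ?thesis
    by simp
qed

lemma norm_orthogonal_matrix_mult:
  fixes C A :: "real^'n^'n"
  assumes "orthogonal_matrix C"
  shows "norm (A ** C) = norm A" and "norm (C ** A) = norm A"
proof -
  have right: "norm (A ** C) = norm A" if "orthogonal_matrix C" for A C :: "real^'n^'n"
  proof -
    have "orthogonal_transformation ((*v) (transpose C))"
      using that by (simp add: orthogonal_transformation_matrix)
    then have "norm ((A ** C) $ i) = norm (A $ i)" for i
    proof -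
      have "(A ** C) $ i = transpose C *v (A $ i)"
        by (simp add: vec_eq_iff matrix_matrix_mult_def matrix_vector_mult_def transpose_def mult.commute)
      then show ?thesis
        using \<open>orthogonal_transformation _\<close> by (simp add: orthogonal_transformation)
    qed
    then show ?thesis
      by (simp add: norm_vec_def[where 'a = "real^'n"])
  qed
  show "norm (A ** C) = norm A"
    by (rule right) fact
  have "norm (C ** A) = norm (transpose A ** transpose C)"
    by (metis matrix_transpose_mul norm_transpose_matrix)
  also have "\<dots> = norm A"
    using assms by (simp add: right norm_transpose_matrix)
  finally show "norm (C ** A) = norm A" .
qed

lemma poly_charpoly: "poly (charpoly A) x = det (mat x - A)"
proof -
  have "map_matrix (\<lambda>p. poly p x) (mat [:0, 1:] - map_matrix (\<lambda>a. [:a:]) A) = mat x - A"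
    by (simp add: vec_eq_iff mat_def)
  then show ?thesis
    using det_map_matrix_hom[of "\<lambda>p. poly p x" "mat [:0, 1:] - map_matrix (\<lambda>a. [:a:]) A"]
    by (simp add: charpoly_def)
qed

lemma charpoly_diagonalizes:
  fixes A :: "real^'n^'n"
  assumes "diagonalizes A C lam"
  shows "charpoly A = (\<Prod>i\<in>UNIV. [:- (lam $ i), 1:])"
proof -
  have C: "orthogonal_matrix C" "A = transpose C ** diag_mat lam ** C"
    using assms by (auto simp: diagonalizes_def matrix_inv_orthogonal)
  have CC: "transpose C ** C = mat 1"
    using C(1) by (simp add: orthogonal_matrix_def)
  have "poly (charpoly A) x = poly (\<Prod>i\<in>UNIV. [:- (lam $ i), 1:]) x" for x
  proof -
    have "transpose C ** (mat x - diag_mat lam) ** C = transpose C ** mat x ** C - A"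
    proof -
      have "transpose C ** (mat x - diag_mat lam) =
          transpose C ** mat x - transpose C ** diag_mat lam"
        by (simp add: vec_eq_iff matrix_matrix_mult_def right_diff_distrib sum_subtractf)
      moreover have "(U - V) ** C = U ** C - V ** C" for U V :: "real^'n^'n"
        by (simp add: vec_eq_iff matrix_matrix_mult_def left_diff_distrib sum_subtractf)
      ultimately show ?thesis
        by (simp add: C(2))
    qed
    also have "transpose C ** mat x ** C = mat x"
    proof -
      have "mat x = x *\<^sub>R (mat 1 :: real^'n^'n)"
        by (simp add: vec_eq_iff mat_def)
      then show ?thesis
        by (simp add: CC matrix_scalar_ac scalar_matrix_assoc[symmetric])
    qed
    finally have "det (mat x - A) = det (transpose C) * det (mat x - diag_mat lam) * det C"
      by (metis det_mul)
    also have "\<dots> = det (transpose C ** C) * det (mat x - diag_mat lam)"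
      by (simp add: det_mul mult_ac)
    also have "\<dots> = det (mat x - diag_mat lam)"
      by (simp add: CC)
    also have "\<dots> = (\<Prod>i\<in>UNIV. x - lam $ i)"
      by (subst det_diagonal) (simp_all add: mat_def diag_mat_def)
    finally show ?thesis
      by (simp add: poly_charpoly poly_prod)
  qed
  then show ?thesis
    by (rule iffD1[OF poly_eq_poly_eq_iff, OF ext])
qed

text \<open>
  The diagonalization splits the characteristic polynomial over the reals, and its roots determine
  the set of eigenvalues whatever order \<open>eigvals\<close> has chosen.
\<close>
lemma range_eigvals:
  fixes A :: "real^'n^'n"
  assumes "diagonalizes A C lam"
  shows "range (($) (eigvals A)) = range (($) lam)"
proof -
  have roots: "{x. poly (\<Prod>i\<in>UNIV. [:- (l $ i), 1:]) x = 0} = range (($) l)" for l :: "real^'n"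
    by (auto simp: poly_prod)
  have "charpoly A = (\<Prod>i\<in>UNIV. [:- (eigvals A $ i), 1:])"
    unfolding eigvals_def by (rule someI) (rule charpoly_diagonalizes[OF assms])
  with charpoly_diagonalizes[OF assms] show ?thesis
    by (metis roots)
qed

section \<open>Estimates on the cone of admissible matrices\<close>

lemma norm_le_sum_norm_rows: "norm (A :: real^'n^'m) \<le> (\<Sum>i\<in>UNIV. norm (A $ i))"
  by (subst norm_vec_def) (rule L2_set_le_sum, simp)

lemma norm_diag_mat_le:
  fixes lam :: "real^'n"
  assumes "\<And>i. \<bar>lam $ i\<bar> \<le> b"
  shows "norm (diag_mat lam) \<le> real CARD('n) * b"
proof -
  have "norm (diag_mat lam $ i) \<le> b" for i
  proof -
    have "diag_mat lam $ i = lam $ i *\<^sub>R axis i 1"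
      by (simp add: diag_mat_def vec_eq_iff axis_def)
    then show ?thesis
      using assms[of i] by simp
  qed
  then have "(\<Sum>i\<in>UNIV. norm (diag_mat lam $ i)) \<le> (\<Sum>i\<in>(UNIV :: 'n set). b)"
    by (intro sum_mono)
  moreover have "norm (diag_mat lam) \<le> (\<Sum>i\<in>UNIV. norm (diag_mat lam $ i))"
    by (rule norm_le_sum_norm_rows)
  ultimately show ?thesis
    by simp
qed

lemma norm_le_onorm:
  fixes A :: "real^'n^'n"
  shows "norm A \<le> (real CARD('n))\<^sup>2 * onorm ((*v) A)"
proof -
  have "norm (A $ i) \<le> real CARD('n) * onorm ((*v) A)" for i
  proof -
    have "norm (A $ i) \<le> (\<Sum>j\<in>UNIV. \<bar>A $ i $ j\<bar>)"
      by (rule norm_le_l1_cart)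
    also have "\<dots> \<le> (\<Sum>j\<in>(UNIV :: 'n set). onorm ((*v) A))"
      by (intro sum_mono matrix_component_le_onorm)
    finally show ?thesis
      by simp
  qed
  then have "(\<Sum>i\<in>UNIV. norm (A $ i)) \<le> (\<Sum>i\<in>(UNIV :: 'n set). real CARD('n) * onorm ((*v) A))"
    by (intro sum_mono)
  moreover have "norm A \<le> (\<Sum>i\<in>UNIV. norm (A $ i))"
    by (rule norm_le_sum_norm_rows)
  ultimately show ?thesis
    by (simp add: power2_eq_square mult.assoc)
qed

lemma symmetric_skew_unique:
  assumes "symmetric_mat \<omega>" "skew_mat \<beta>" "symmetric_mat \<omega>'" "skew_mat \<beta>'" "\<omega> + \<beta> = \<omega>' + \<beta>'"
  shows "\<omega> = \<omega>'" and "\<beta> = \<beta>'"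
proof -
  have entries: "A $ j $ i = A $ i $ j" if "symmetric_mat A" for A :: "real^'a^'a" and i j
  proof -
    have "transpose A $ i $ j = A $ i $ j"
      using that by (simp add: symmetric_mat_def)
    then show ?thesis
      by (simp add: transpose_def)
  qed
  have entries': "A $ j $ i = - A $ i $ j" if "skew_mat A" for A :: "real^'a^'a" and i j
  proof -
    have "transpose A $ i $ j = (- A) $ i $ j"
      using that by (simp add: skew_mat_def)
    then show ?thesis
      by (simp add: transpose_def)
  qed
  have sum: "\<omega> $ i $ j + \<beta> $ i $ j = \<omega>' $ i $ j + \<beta>' $ i $ j" for i j
    using assms(5) by (metis vector_add_component)
  have "\<omega> $ i $ j = \<omega>' $ i $ j" for i j
    using sum[of i j] sum[of j i] entries[OF assms(1), of i j] entries[OF assms(3), of i j]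
      entries'[OF assms(2), of i j] entries'[OF assms(4), of i j]
    by linarith
  then show "\<omega> = \<omega>'"
    by (simp add: vec_eq_iff)
  with assms(5) show "\<beta> = \<beta>'"
    by simp
qed

lemma skew_mat_quadratic_form:
  assumes "skew_mat \<beta>"
  shows "x \<bullet> (\<beta> *v x) = 0"
proof -
  have "x \<bullet> (\<beta> *v x) = (x v* \<beta>) \<bullet> x"
    by (rule dot_lmul_matrix[symmetric])
  also have "x v* \<beta> = transpose \<beta> *v x"
    by (metis transpose_transpose vector_transpose_matrix)
  also have "\<dots> = - (\<beta> *v x)"
    using assms unfolding skew_mat_def by (simp add: matrix_vector_mult_def vec_eq_iff sum_negf)
  finally show ?thesis
    by (simp add: inner_commute)
qed

lemma diag_mat_vector_mult: "(diag_mat d *v x) $ i = d $ i * x $ i"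
  by (simp add: matrix_vector_mult_def diag_mat_def mult_delta_left)

text \<open>
  In the coordinates \<open>C *v x\<close> the form is the sum of the squares weighted with the eigenvalues.
\<close>
lemma diagonalizes_quadratic_form_ge:
  fixes A :: "real^'n^'n"
  assumes "diagonalizes A C lam" and "\<And>i. s \<le> lam $ i"
  shows "s * (x \<bullet> x) \<le> x \<bullet> (A *v x)"
proof -
  have C: "orthogonal_matrix C" "A = transpose C ** diag_mat lam ** C"
    using assms(1) by (auto simp: diagonalizes_def matrix_inv_orthogonal)
  let ?y = "C *v x"
  have "x \<bullet> (A *v x) = x \<bullet> (transpose C *v (diag_mat lam *v ?y))"
    by (simp add: C(2) matrix_vector_mul_assoc matrix_mul_assoc)
  also have "\<dots> = (x v* transpose C) \<bullet> (diag_mat lam *v ?y)"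
    by (rule dot_lmul_matrix[symmetric])
  also have "x v* transpose C = ?y"
    by (rule vector_transpose_matrix)
  also have "?y \<bullet> (diag_mat lam *v ?y) = (\<Sum>i\<in>UNIV. lam $ i * (?y $ i * ?y $ i))"
    by (simp add: inner_vec_def diag_mat_vector_mult mult_ac)
  also have "\<dots> \<ge> (\<Sum>i\<in>UNIV. s * (?y $ i * ?y $ i))"
    by (intro sum_mono mult_right_mono assms(2)) simp
  also have "(\<Sum>i\<in>UNIV. s * (?y $ i * ?y $ i)) = s * (?y \<bullet> ?y)"
    by (simp add: inner_vec_def sum_distrib_left)
  also have "?y \<bullet> ?y = x \<bullet> x"
    using C(1) orthogonal_transformation_matrix[of "(*v) C"]
    by (simp add: orthogonal_transformation_def)
  finally show ?thesis .
qed

text \<open>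
  Conjugation with an orthogonal matrix preserves the Frobenius norm, and the scaling on both sides
  divides each entry by a number that is at most \<open>b\<close>.
\<close>
lemma norm_P_tilde2_ge:
  fixes P C :: "real^'n^'n"
  assumes C: "orthogonal_matrix C" and lam: "\<And>i. 0 < lam $ i" "\<And>i. lam $ i \<le> b"
  shows "(norm P / b)\<^sup>2 \<le> (norm (P_tilde2 C lam P))\<^sup>2"
proof -
  have b: "0 < b"
    using lam[of undefined] by linarith
  let ?Q = "C ** P ** matrix_inv C"
  have "norm ?Q = norm P"
    using C by (simp add: matrix_inv_orthogonal norm_orthogonal_matrix_mult)
  then have "(norm P / b)\<^sup>2 = (\<Sum>i\<in>UNIV. \<Sum>j\<in>UNIV. (?Q $ i $ j / b)\<^sup>2)"
    using norm_matrix_sq[of ?Q] by (simp add: power_divide sum_divide_distrib)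
  also have "\<dots> \<le> (\<Sum>i\<in>UNIV. \<Sum>j\<in>UNIV. (P_tilde2 C lam P $ i $ j)\<^sup>2)"
  proof (intro sum_mono)
    fix i j :: 'n
    have entry: "P_tilde2 C lam P $ i $ j = lam $ i powr (- 1 / 2) * ?Q $ i $ j * lam $ j powr (- 1 / 2)"
      by (simp add: P_tilde2_def Let_def diag_mat_mult_left diag_mat_mult_right)
    have sq: "(lam $ i powr (- 1 / 2))\<^sup>2 = 1 / lam $ i" for i
      using lam(1)[of i] by (simp add: power2_eq_square powr_neg_one flip: powr_add)
    have "(P_tilde2 C lam P $ i $ j)\<^sup>2 = (1 / lam $ i) * (1 / lam $ j) * (?Q $ i $ j)\<^sup>2"
      unfolding entry power_mult_distrib sq by (simp add: mult_ac)
    moreover have "(1 / b) * (1 / b) \<le> (1 / lam $ i) * (1 / lam $ j)"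
      using lam b by (intro mult_mono divide_left_mono) (simp_all add: less_imp_le)
    ultimately show "(?Q $ i $ j / b)\<^sup>2 \<le> (P_tilde2 C lam P $ i $ j)\<^sup>2"
      using mult_right_mono[of "(1 / b) * (1 / b)" "(1 / lam $ i) * (1 / lam $ j)" "(?Q $ i $ j)\<^sup>2"]
      by (simp add: power2_eq_square)
  qed
  finally show ?thesis
    by (simp add: norm_matrix_sq)
qed

text \<open>
  Membership in \<open>D_gamma\<close> speaks of some decomposition of \<open>\<omega> + \<beta>\<close>, which must be the given one.
  The pinching condition on the eigenvalues then keeps the spectrum of \<open>\<omega>\<close> below a fixed
  multiple of its least element.
\<close>
lemma D_gamma_diagonalization:
  fixes \<omega> \<beta> :: "real^'n^'n"
  assumes "symmetric_mat \<omega>" "skew_mat \<beta>" "\<omega> + \<beta> \<in> D_gamma \<delta> \<mu> \<gamma>"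
    and "0 < \<gamma>" "\<delta> \<le> 1"
  obtains C lam where "diagonalizes \<omega> C lam" "0 < lambda_min \<omega>"
    "\<And>i. lambda_min \<omega> \<le> lam $ i" "\<And>i. lam $ i \<le> lambda_min \<omega> / \<gamma>"
    "onorm ((*v) \<beta>) \<le> lambda_min \<omega>"
proof -
  have "eigvals \<omega> \<in> Sigma_set \<gamma>" "\<omega> + \<beta> \<in> D_set \<delta> \<mu>"
    using assms(3) symmetric_skew_unique(1)[OF assms(1,2)] unfolding D_gamma_def by auto
  then have "onorm ((*v) \<beta>) \<le> \<delta> * lambda_min \<omega>"
    using symmetric_skew_unique[OF assms(1,2)] unfolding D_set_def by force
  obtain C lam where diag: "diagonalizes \<omega> C lam"
    using symmetric_mat_diagonalizable[OF assms(1)] by metis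
  let ?r = "range (($) lam)"
  have range: "range (\<lambda>i. eigvals \<omega> $ i) = ?r"
    using range_eigvals[OF diag] .
  then have min: "lambda_min \<omega> = Min ?r"
    by (simp add: lambda_min_def)
  have pos: "0 < x" if "x \<in> ?r" for x
    using \<open>eigvals \<omega> \<in> _\<close> that unfolding range[symmetric] by (auto simp: Sigma_set_def Gamma_cone_def)
  have "\<gamma> * Max ?r \<le> Min ?r"
    using \<open>eigvals \<omega> \<in> _\<close> unfolding Sigma_set_def range[symmetric] by blast
  show thesis
  proof (rule that[OF diag])
    show "0 < lambda_min \<omega>"
      unfolding min by (intro pos Min_in) simp_all
    then have "\<delta> * lambda_min \<omega> \<le> lambda_min \<omega>"
      using assms(5) mult_right_mono[of \<delta> 1 "lambda_min \<omega>"] by simp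
    with \<open>onorm ((*v) \<beta>) \<le> _\<close> show "onorm ((*v) \<beta>) \<le> lambda_min \<omega>"
      by linarith
    show "lambda_min \<omega> \<le> lam $ i" for i
      unfolding min by (intro Min_le) simp_all
    show "lam $ i \<le> lambda_min \<omega> / \<gamma>" for i
    proof -
      have "lam $ i \<le> Max ?r"
        by (intro Max_ge) simp_all
      then have "\<gamma> * lam $ i \<le> \<gamma> * Max ?r"
        using assms(4) by simp
      then have "\<gamma> * lam $ i \<le> lambda_min \<omega>"
        using \<open>\<gamma> * Max ?r \<le> Min ?r\<close> unfolding min by (rule order_trans)
      then show ?thesis
        using assms(4) by (simp add: field_simps)
    qed
  qed
qed

text \<open>
  The skew part does not change the quadratic form, so \<open>\<omega> + \<beta>\<close> is as coercive as \<open>\<omega>\<close>; both parts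
  have norm at most a constant times \<open>lambda_min \<omega>\<close>.  Thus \<open>lambda_min \<omega>\<close> can serve as the scale.
\<close>
lemma hessian_form_bound_on_D_gamma:
  assumes "k \<le> CARD('n)" "0 < \<gamma>"
  shows "\<exists>K > 0. \<forall>(\<omega> :: real^'n^'n) \<beta> \<delta> \<mu> M N. symmetric_mat \<omega> \<longrightarrow> skew_mat \<beta> \<longrightarrow>
    \<omega> + \<beta> \<in> D_gamma \<delta> \<mu> \<gamma> \<longrightarrow> \<delta> \<le> 1 \<longrightarrow>
    \<bar>hessian_form k (\<omega> + \<beta>) M N\<bar> \<le> K * norm M * norm N / (lambda_min \<omega>)\<^sup>2"
proof -
  let ?n = "real CARD('n)"
  \<comment> \<open>the first term bounds \<open>\<omega>\<close> through its eigenvalues, the second one \<open>\<beta>\<close> through its operator norm\<close>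
  let ?r = "?n / \<gamma> + ?n\<^sup>2"
  obtain K where "0 < K" and K: "\<And>(R :: real^'n^'n) M N s. 0 < s \<Longrightarrow> norm R \<le> ?r * s \<Longrightarrow>
      (\<And>x. s * (x \<bullet> x) \<le> x \<bullet> (R *v x)) \<Longrightarrow> \<bar>hessian_form k R M N\<bar> \<le> K * norm M * norm N / s\<^sup>2"
    using hessian_form_bound[OF assms(1), of ?r] by blast
  have "\<bar>hessian_form k (\<omega> + \<beta>) M N\<bar> \<le> K * norm M * norm N / (lambda_min \<omega>)\<^sup>2"
    if \<omega>: "symmetric_mat \<omega>" and \<beta>: "skew_mat \<beta>" and D: "\<omega> + \<beta> \<in> D_gamma \<delta> \<mu> \<gamma>" and \<delta>: "\<delta> \<le> 1"
    for \<omega> \<beta> M N :: "real^'n^'n" and \<delta> \<mu>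
  proof -
    obtain C lam where diag: "diagonalizes \<omega> C lam" and s: "0 < lambda_min \<omega>"
      and lam: "\<And>i. lambda_min \<omega> \<le> lam $ i" "\<And>i. lam $ i \<le> lambda_min \<omega> / \<gamma>"
      and onorm: "onorm ((*v) \<beta>) \<le> lambda_min \<omega>"
      using D_gamma_diagonalization[OF \<omega> \<beta> D assms(2) \<delta>] by blast
    have C: "orthogonal_matrix C" "\<omega> = transpose C ** diag_mat lam ** C"
      using diag by (auto simp: diagonalizes_def matrix_inv_orthogonal)
    have "\<bar>lam $ i\<bar> \<le> lambda_min \<omega> / \<gamma>" for i
      using lam[of i] s by linarith
    then have "norm (diag_mat lam) \<le> ?n * (lambda_min \<omega> / \<gamma>)"
      by (rule norm_diag_mat_le)
    moreover have "norm \<omega> = norm (diag_mat lam)"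
      using C(1) by (subst C(2)) (simp add: norm_orthogonal_matrix_mult)
    moreover have "norm \<beta> \<le> ?n\<^sup>2 * lambda_min \<omega>"
      using norm_le_onorm[of \<beta>] onorm by (meson mult_left_mono order_trans zero_le_power2)
    ultimately have "norm (\<omega> + \<beta>) \<le> ?r * lambda_min \<omega>"
      using norm_triangle_ineq[of \<omega> \<beta>] by (simp add: distrib_right)
    moreover have "lambda_min \<omega> * (x \<bullet> x) \<le> x \<bullet> ((\<omega> + \<beta>) *v x)" for x
      using diagonalizes_quadratic_form_ge[OF diag lam(1)] skew_mat_quadratic_form[OF \<beta>]
      by (simp add: matrix_vector_mult_add_rdistrib inner_add_right)
    ultimately show ?thesis
      by (intro K s)
  qed
  with \<open>0 < K\<close> show ?thesis
    by blast
qed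

lemma complete_square_bound:
  fixes p q K c :: real
  assumes "0 < c"
  shows "- c * p\<^sup>2 + 2 * K * p * q + K * q\<^sup>2 \<le> (K\<^sup>2 / c + K) * q\<^sup>2"
proof -
  have "0 \<le> (c * p - K * q)\<^sup>2 / c"
    using assms by simp
  also have "\<dots> = c * p\<^sup>2 - 2 * K * p * q + K\<^sup>2 / c * q\<^sup>2"
    using assms by (simp add: field_simps power2_eq_square)
  finally show ?thesis
    by (simp add: algebra_simps)
qed

theorem theorem5p3:
  fixes k :: nat and \<gamma> \<delta>\<^sub>0 :: real
  assumes "2 \<le> k" and "k \<le> CARD('n::finite) - 1"
    and "0 < \<gamma>" and "\<gamma> < 1" and "gamma_admissible CARD('n) k \<gamma>"
    and "0 < \<delta>\<^sub>0" and "\<delta>\<^sub>0 < 1"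
    and "\<exists>C\<^sub>1\<^sub>0 > 0. \<forall>\<mu> > 0. \<forall>\<delta>. 0 < \<delta> \<and> \<delta> \<le> \<delta>\<^sub>0 \<longrightarrow>
      (\<forall>(\<omega> :: real^'n^'n) \<beta> C lam P.
         symmetric_mat \<omega> \<and> skew_mat \<beta> \<and> \<omega> + \<beta> \<in> D_gamma \<delta> \<mu> \<gamma> \<and>
         diagonalizes \<omega> C lam \<and> symmetric_mat P \<longrightarrow>
         d2F k (\<omega> + \<beta>) P \<le> - C\<^sub>1\<^sub>0 * (norm (P_tilde2 C lam P))\<^sup>2)"
  shows "\<exists>\<delta>\<^sub>1 C\<^sub>1\<^sub>2. 0 < \<delta>\<^sub>1 \<and> \<delta>\<^sub>1 \<le> \<delta>\<^sub>0 \<and> 0 < C\<^sub>1\<^sub>2 \<and>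
    (\<forall>\<mu> > 0. \<forall>\<delta>. 0 < \<delta> \<and> \<delta> \<le> \<delta>\<^sub>1 \<longrightarrow>
      (\<forall>(\<omega> :: real^'n^'n) \<beta> P Q.
         symmetric_mat \<omega> \<and> skew_mat \<beta> \<and> \<omega> + \<beta> \<in> D_gamma \<delta> \<mu> \<gamma> \<and>
         symmetric_mat P \<and> skew_mat Q \<longrightarrow>
         d2F k (\<omega> + \<beta>) (P + Q) \<le> C\<^sub>1\<^sub>2 * ((norm Q)\<^sup>2 / (lambda_min \<omega>)\<^sup>2)))"
proof -
  from assms(8) obtain c where "0 < c" and concave: "\<forall>\<mu> > 0. \<forall>\<delta>. 0 < \<delta> \<and> \<delta> \<le> \<delta>\<^sub>0 \<longrightarrow>
      (\<forall>(\<omega> :: real^'n^'n) \<beta> C lam P.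
         symmetric_mat \<omega> \<and> skew_mat \<beta> \<and> \<omega> + \<beta> \<in> D_gamma \<delta> \<mu> \<gamma> \<and>
         diagonalizes \<omega> C lam \<and> symmetric_mat P \<longrightarrow>
         d2F k (\<omega> + \<beta>) P \<le> - c * (norm (P_tilde2 C lam P))\<^sup>2)"
    by (elim exE conjE)
  have "k \<le> CARD('n)"
    using assms(2) by simp
  then obtain K where "0 < K" and K: "\<And>(\<omega> :: real^'n^'n) \<beta> \<delta> \<mu> M N. symmetric_mat \<omega> \<Longrightarrow>
      skew_mat \<beta> \<Longrightarrow> \<omega> + \<beta> \<in> D_gamma \<delta> \<mu> \<gamma> \<Longrightarrow> \<delta> \<le> 1 \<Longrightarrow>
      \<bar>hessian_form k (\<omega> + \<beta>) M N\<bar> \<le> K * norm M * norm N / (lambda_min \<omega>)\<^sup>2"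
    using hessian_form_bound_on_D_gamma[OF _ assms(3)] by blast
  \<comment> \<open>the eigenvalues are at most \<open>lambda_min \<omega> / \<gamma>\<close>, so passing from the scaled matrix to \<open>P\<close> costs \<open>\<gamma>\<^sup>2\<close>\<close>
  let ?c = "c * \<gamma>\<^sup>2"
  have c: "0 < ?c"
    using \<open>0 < c\<close> assms(3) by simp
  have bound: "d2F k (\<omega> + \<beta>) (P + Q) \<le> (K\<^sup>2 / ?c + K) * ((norm Q)\<^sup>2 / (lambda_min \<omega>)\<^sup>2)"
    if \<mu>: "0 < \<mu>" and \<delta>: "0 < \<delta>" "\<delta> \<le> \<delta>\<^sub>0" and \<omega>: "symmetric_mat \<omega>" and \<beta>: "skew_mat \<beta>"
      and D: "\<omega> + \<beta> \<in> D_gamma \<delta> \<mu> \<gamma>" and P: "symmetric_mat P"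
    for \<mu> \<delta> and \<omega> \<beta> P Q :: "real^'n^'n"
  proof -
    have "\<delta> \<le> 1"
      using \<delta>(2) assms(7) by linarith
    obtain C lam where diag: "diagonalizes \<omega> C lam" and s: "0 < lambda_min \<omega>"
      and lam: "\<And>i. lambda_min \<omega> \<le> lam $ i" "\<And>i. lam $ i \<le> lambda_min \<omega> / \<gamma>"
      and "onorm ((*v) \<beta>) \<le> lambda_min \<omega>"
      using D_gamma_diagonalization[OF \<omega> \<beta> D assms(3) \<open>\<delta> \<le> 1\<close>] by blast
    let ?s = "lambda_min \<omega>" and ?p = "norm P" and ?q = "norm Q"
    have "(?p / (?s / \<gamma>))\<^sup>2 \<le> (norm (P_tilde2 C lam P))\<^sup>2"
    proof (rule norm_P_tilde2_ge)
      show "orthogonal_matrix C"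
        using diag by (simp add: diagonalizes_def)
      show "0 < lam $ i" for i
        using s lam(1)[of i] by linarith
    qed (rule lam(2))
    then have "c * (?p / (?s / \<gamma>))\<^sup>2 \<le> c * (norm (P_tilde2 C lam P))\<^sup>2"
      using \<open>0 < c\<close> by (intro mult_left_mono) simp_all
    moreover have "d2F k (\<omega> + \<beta>) P \<le> - c * (norm (P_tilde2 C lam P))\<^sup>2"
      by (rule concave[rule_format, OF \<mu> conjI[OF \<delta>]]) (intro conjI \<omega> \<beta> D diag P)
    ultimately have PP: "d2F k (\<omega> + \<beta>) P \<le> - ?c * ?p\<^sup>2 / ?s\<^sup>2"
      by (simp add: power_divide power_mult_distrib mult_ac)
    have bound: "hessian_form k (\<omega> + \<beta>) M N \<le> K * norm M * norm N / ?s\<^sup>2" for M N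
      using K[OF \<omega> \<beta> D \<open>\<delta> \<le> 1\<close>, of M N] by linarith
    have "d2F k (\<omega> + \<beta>) (P + Q) \<le> - ?c * ?p\<^sup>2 / ?s\<^sup>2 +
        (K * ?p * ?q / ?s\<^sup>2 + K * ?q * ?p / ?s\<^sup>2) + K * ?q * ?q / ?s\<^sup>2"
      unfolding d2F_add by (intro add_mono PP bound)
    also have "\<dots> = (- ?c * ?p\<^sup>2 + 2 * K * ?p * ?q + K * ?q\<^sup>2) / ?s\<^sup>2"
      by (simp add: add_divide_distrib diff_divide_distrib power2_eq_square mult_ac)
    also have "\<dots> \<le> (K\<^sup>2 / ?c + K) * ?q\<^sup>2 / ?s\<^sup>2"
      by (intro divide_right_mono complete_square_bound c) simp
    finally show ?thesis
      by simp
  qed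
  show ?thesis
  proof (rule exI[of _ \<delta>\<^sub>0], rule exI[of _ "K\<^sup>2 / ?c + K"], intro conjI allI impI)
    show "0 < K\<^sup>2 / ?c + K"
      using \<open>0 < K\<close> c by (intro add_nonneg_pos) simp_all
  qed (use assms(6) in \<open>blast intro: bound\<close>)+
qed

end
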